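(* Let $n\ge2$ and let $\mathscr{L}:\Pi^n\to\mathbb{R}$ be a square positive linear functional having property (P) (defined in the context) with polynomials $l_1,\ldots,l_n$. Let $T:\mathbb{R}^n\to\mathbb{R}^n$, $T(x)=(l_1(x),\ldots,l_n(x))$, and let $\mathscr{L}'$ be the functional on $\mathbb{R}[t_1,\ldots,t_n]$ given by $\mathscr{L}'(g)=\mathscr{L}(g(l_1,\ldots,l_n))$. Let $\xi_1,\xi_2\in\mathbb{R}$ with $\xi_1+\xi_2=\mathscr{L}'(1)$. Suppose that real numbers $\omega_1,\ldots,\omega_{N+2}$, $v_{m,i}$ ($1\le m\le N$, $1\le i\le n-1$), $v_{N+1,n}$, $v_{N+2,n}$ solve the following two moment problems: the $(n-1)$-dimensional one, $$\sum_{m=1}^N\omega_m=\xi_1,\quad \sum_{m=1}^N\omega_mv_{m,i}=\mathscr{L}'(t_i),\quad \sum_{m=1}^N\omega_mv_{m,i}v_{m,j}=\mathscr{L}'(t_it_j),\quad \sum_{m=1}^N\omega_mv_{m,i}v_{m,j}v_{m,k}=\mathscr{L}'(t_it_jt_k)$$ for all $i,j,k\in\{1,\ldots,n-1\}$, and the one-dimensional one, $$\omega_{N+1}+\omega_{N+2}=\xi_2,\qquad \omega_{N+1}v_{N+1,n}^s+\omega_{N+2}v_{N+2,n}^s=\mathscr{L}'(t_n^s),\quad s=1,2,3.$$ Then the cubature formula with nodes $v^{(m)}=(v_{m,1},\ldots,v_{m,n-1},0)$ ($1\le m\le N$), $v^{(N+j)}=(0,\ldots,0,v_{N+j,n})$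 ($j=1,2$) and weights $\omega_1,\ldots,\omega_{N+2}$ satisfies $$\mathscr{L}'(g)=\sum_{m=1}^{N+2}\omega_m\,g(v^{(m)})$$ for all $g\in\mathbb{R}[t_1,\ldots,t_n]$ of degree at most $3$, and consequently $\mathscr{L}(f)=\sum_{m=1}^{N+2}\omega_m f(T^{-1}(v^{(m)}))$ for all $f\in\Pi^n$ of degree at most $3$.
   Context: $\Pi^n=\mathbb{R}[x_1,\ldots,x_n]$. A linear functional $\mathscr{L}:\Pi^n\to\mathbb{R}$ is square positive if $\mathscr{L}(p^2)>0$ for every nonzero $p$. Property (P): there exist $n$ linearly independent polynomials $l_i(x_1,\ldots,x_n)$, $i=1,\ldots,n$, of degree one such that each product $l_il_n$ ($i=1,\ldots,n-1$) is an orthogonal polynomial of degree two with respect to $\mathscr{L}$, i.e. $\mathscr{L}(l_il_n\,p)=0$ for every polynomial $p\in\Pi^n$ of degree at most $1$. Here linear independence is understood for the homogeneous linear parts of the $l_i$, so that the affine map $T=(l_1,\ldots,l_n)$ is invertible. *)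

theory Defs
  imports "HOL-Analysis.Analysis" "HOL-Library.Poly_Mapping"
begin

text \<open>
  Real polynomials in variables indexed by a finite type \<open>'n\<close>: finitely supported maps from
  exponent vectors to coefficients. The ring operations (convolution product) are those of
  \<^theory>\<open>HOL-Library.Poly_Mapping\<close>. The number of variables is \<open>CARD('n)\<close>.
\<close>

type_synonym 'n rpoly = "('n \<Rightarrow>\<^sub>0 nat) \<Rightarrow>\<^sub>0 real"

definition Const :: "real \<Rightarrow> 'n rpoly" where
  "Const c = Poly_Mapping.single 0 c"

definition Var :: "'n \<Rightarrow> 'n rpoly" where
  "Var i = Poly_Mapping.single (Poly_Mapping.single i 1) 1"

definition mon_degree :: "('n::finite \<Rightarrow>\<^sub>0 nat) \<Rightarrow> nat" where
  "mon_degree m = (\<Sum>i\<in>UNIV. Poly_Mapping.lookup m i)"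

text \<open>The zero polynomial gets degree 0.\<close>

definition total_degree :: "'n::finite rpoly \<Rightarrow> nat" where
  "total_degree p = Max (insert 0 (mon_degree ` Poly_Mapping.keys p))"

definition linear_part :: "'n::finite rpoly \<Rightarrow> 'n rpoly" where
  "linear_part p = (\<Sum>i\<in>UNIV. Const (Poly_Mapping.lookup p (Poly_Mapping.single i 1)) * Var i)"

definition poly_at :: "'n::finite rpoly \<Rightarrow> real ^ 'n \<Rightarrow> real" where
  "poly_at p x = (\<Sum>m\<in>Poly_Mapping.keys p.
     Poly_Mapping.lookup p m * (\<Prod>i\<in>UNIV. (x $ i) ^ Poly_Mapping.lookup m i))"

text \<open>\<open>poly_subst l g\<close> is the polynomial \<open>g(l\<^sub>1, \<dots>, l\<^sub>n)\<close>.\<close>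

definition poly_subst :: "('n::finite \<Rightarrow> 'n rpoly) \<Rightarrow> 'n rpoly \<Rightarrow> 'n rpoly" where
  "poly_subst l g = (\<Sum>m\<in>Poly_Mapping.keys g.
     Const (Poly_Mapping.lookup g m) * (\<Prod>i\<in>UNIV. l i ^ Poly_Mapping.lookup m i))"

definition linear_functional :: "('n rpoly \<Rightarrow> real) \<Rightarrow> bool" where
  "linear_functional L \<longleftrightarrow>
     (\<forall>p q. L (p + q) = L p + L q) \<and> (\<forall>c p. L (Const c * p) = c * L p)"

definition square_positive :: "('n rpoly \<Rightarrow> real) \<Rightarrow> bool" where
  "square_positive L \<longleftrightarrow> (\<forall>p. p \<noteq> 0 \<longrightarrow> L (p ^ 2) > 0)"

definition orthogonal_polynomial :: "('n::finite rpoly \<Rightarrow> real) \<Rightarrow> nat \<Rightarrow> 'n rpoly \<Rightarrow> bool" where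
  "orthogonal_polynomial L d q \<longleftrightarrow>
     total_degree q = d \<and> (\<forall>p. total_degree p < d \<longrightarrow> L (q * p) = 0)"

text \<open>
  Property (P), witnessed by the family \<open>l\<close>. The index \<open>e\<close> plays the role of the last index \<open>n\<close>,
  so that the indices \<open>1, \<dots>, n - 1\<close> are those different from \<open>e\<close>.
\<close>

definition property_P_with ::
    "('n::finite rpoly \<Rightarrow> real) \<Rightarrow> 'n \<Rightarrow> ('n \<Rightarrow> 'n rpoly) \<Rightarrow> bool" where
  "property_P_with L e l \<longleftrightarrow>
     (\<forall>i. total_degree (l i) = 1) \<and>
     (\<forall>c. (\<Sum>i\<in>UNIV. Const (c i) * linear_part (l i)) = 0 \<longrightarrow> (\<forall>i. c i = 0)) \<and>
     (\<forall>i. i \<noteq> e \<longrightarrow> orthogonal_polynomial L 2 (l i * l e))"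

definition affine_map :: "('n::finite \<Rightarrow> 'n rpoly) \<Rightarrow> real ^ 'n \<Rightarrow> real ^ 'n" where
  "affine_map l x = (\<chi> i. poly_at (l i) x)"

definition transformed_functional ::
    "('n::finite rpoly \<Rightarrow> real) \<Rightarrow> ('n \<Rightarrow> 'n rpoly) \<Rightarrow> 'n rpoly \<Rightarrow> real" where
  "transformed_functional L l g = L (poly_subst l g)"

text \<open>
  The nodes: for \<open>m \<le> N\<close> they lie in the hyperplane where coordinate \<open>e\<close> vanishes, and for
  \<open>m = N + 1, N + 2\<close> they lie on the coordinate axis \<open>e\<close>. Values of \<open>v\<close> not used here
  (\<open>v m e\<close> for \<open>m \<le> N\<close> and \<open>v m i\<close> with \<open>i \<noteq> e\<close> for \<open>m > N\<close>) are irrelevant.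
\<close>

definition cubature_node ::
    "'n::finite \<Rightarrow> nat \<Rightarrow> (nat \<Rightarrow> 'n \<Rightarrow> real) \<Rightarrow> nat \<Rightarrow> real ^ 'n" where
  "cubature_node e N v m =
     (if m \<le> N then (\<chi> i. if i = e then 0 else v m i)
      else (\<chi> i. if i = e then v m e else 0))"

end

theory Submission
  imports Defs
begin

text \<open>
  Both sides of the formula are linear in \<open>g\<close>, so it suffices to compare them on monomials of
  degree at most 3. On monomials in the \<open>t\<^sub>i\<close> with \<open>i \<noteq> e\<close> alone, and on powers of \<open>t\<^sub>e\<close>, this is
  what the two moment problems say. A mixed monomial is \<open>t\<^sub>i t\<^sub>e\<close> times a factor of degree at most
  1: the transformed functional vanishes on it by property (P), and so does the cubature sum, since
  each node lies on the hyperplane \<open>t\<^sub>e = 0\<close> or on the axis of \<open>t\<^sub>e\<close>. The formula for \<open>L\<close> follows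
  because the invertibility of the affine map makes every \<open>f\<close> of the form \<open>g(l\<^sub>1, \<dots>, l\<^sub>n)\<close> with
  \<open>g\<close> of the same degree bound.
\<close>

subsection \<open>Evaluation homomorphisms\<close>

lemma sum_keys_superset:
  fixes \<phi> :: "real \<Rightarrow> 'a::comm_ring_1"
  assumes "\<phi> 0 = 0" "finite S" "Poly_Mapping.keys p \<subseteq> S"
  shows "(\<Sum>m\<in>Poly_Mapping.keys p. \<phi> (Poly_Mapping.lookup p m) * \<psi> m)
    = (\<Sum>m\<in>S. \<phi> (Poly_Mapping.lookup p m) * \<psi> m)"
  using assms by (intro sum.mono_neutral_left) (auto simp: in_keys_iff)

text \<open>The supports of \<open>p\<close>, \<open>q\<close> and \<open>p + q\<close> may differ
  through cancellation. Since \<open>\<phi> 0 = 0\<close>, all three sums can be taken over the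
  union of the supports of \<open>p\<close> and \<open>q\<close>. The pair \<open>\<phi>\<close>,
  \<open>\<psi>\<close> covers \<open>poly_at\<close> and \<open>poly_subst\<close> at once.\<close>

lemma sum_keys_add:
  fixes \<phi> :: "real \<Rightarrow> 'a::comm_ring_1" and \<psi> :: "'k \<Rightarrow> 'a"
  assumes zero: "\<phi> 0 = 0" and add: "\<And>a b. \<phi> (a + b) = \<phi> a + \<phi> b"
  defines "F \<equiv> \<lambda>p. \<Sum>m\<in>Poly_Mapping.keys p. \<phi> (Poly_Mapping.lookup p m) * \<psi> m"
  shows "F (p + q) = F p + F q"
proof -
  let ?S = "Poly_Mapping.keys p \<union> Poly_Mapping.keys q"
  have "F r = (\<Sum>m\<in>?S. \<phi> (Poly_Mapping.lookup r m) * \<psi> m)"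
    if "Poly_Mapping.keys r \<subseteq> ?S" for r
    unfolding F_def using zero that by (intro sum_keys_superset) auto
  then show ?thesis
    using keys_add[of p q] by (simp add: lookup_add add distrib_right sum.distrib)
qed

lemma poly_mapping_sum_single:
  "p = (\<Sum>m\<in>Poly_Mapping.keys p. Poly_Mapping.single m (Poly_Mapping.lookup p m))"
proof (rule poly_mapping_eqI)
  fix k
  show "Poly_Mapping.lookup p k = Poly_Mapping.lookup
      (\<Sum>m\<in>Poly_Mapping.keys p. Poly_Mapping.single m (Poly_Mapping.lookup p m)) k"
    by (simp add: lookup_sum lookup_single when_def in_keys_iff)
qed

text \<open>This is the map out of the monoid algebra induced by a coefficient map
  \<open>\<phi>\<close> and a multiplicative map \<open>\<psi>\<close> on exponents. Additivity
  reduces multiplicativity to products of single terms.\<close>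

lemma sum_keys_mult:
  fixes \<phi> :: "real \<Rightarrow> 'a::comm_ring_1" and \<psi> :: "'k::comm_monoid_add \<Rightarrow> 'a"
  assumes zero: "\<phi> 0 = 0" and add: "\<And>a b. \<phi> (a + b) = \<phi> a + \<phi> b"
    and mult: "\<And>a b. \<phi> (a * b) = \<phi> a * \<phi> b" and hom: "\<And>k k'. \<psi> (k + k') = \<psi> k * \<psi> k'"
  defines "F \<equiv> \<lambda>p. \<Sum>m\<in>Poly_Mapping.keys p. \<phi> (Poly_Mapping.lookup p m) * \<psi> m"
  shows "F (p * q) = F p * F q"
proof -
  have F_add: "F (p + q) = F p + F q" for p q
    unfolding F_def by (rule sum_keys_add[OF zero add])
  have F_sum: "F (sum f A) = (\<Sum>a\<in>A. F (f a))" for f :: "'k \<Rightarrow> _" and A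
    by (induction A rule: infinite_finite_induct) (simp_all add: F_add, simp_all add: F_def)
  have F_single: "F (Poly_Mapping.single k c) = \<phi> c * \<psi> k" for k c
    by (simp add: F_def zero)
  have "p * q = (\<Sum>a\<in>Poly_Mapping.keys p. \<Sum>b\<in>Poly_Mapping.keys q.
      Poly_Mapping.single (a + b) (Poly_Mapping.lookup p a * Poly_Mapping.lookup q b))"
    by (simp add: mult_single[symmetric] sum_product[symmetric] poly_mapping_sum_single[symmetric])
  then have "F (p * q) = (\<Sum>a\<in>Poly_Mapping.keys p. \<Sum>b\<in>Poly_Mapping.keys q.
      (\<phi> (Poly_Mapping.lookup p a) * \<psi> a) * (\<phi> (Poly_Mapping.lookup q b) * \<psi> b))"
    by (simp add: F_sum F_single mult hom mult_ac)
  then show ?thesis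
    by (simp add: F_def sum_product)
qed

lemma Const_0 [simp]: "Const 0 = 0"
  by (simp add: Const_def)

lemma Const_1 [simp]: "Const 1 = 1"
  by (simp add: Const_def)

lemma Const_add: "Const (a + b) = Const a + Const b"
  by (simp add: Const_def single_add)

lemma Const_mult: "Const (a * b) = Const a * Const b"
  by (simp add: Const_def mult_single)

lemma Const_uminus: "Const (- a) = - Const a"
  by (simp add: Const_def single_uminus)

lemma Const_sum: "Const (sum f A) = (\<Sum>a\<in>A. Const (f a))"
  by (induction A rule: infinite_finite_induct) (simp_all add: Const_add)

lemma lookup_Const_mult: "Poly_Mapping.lookup (Const c * p) m = c * Poly_Mapping.lookup p m"
proof -
  have "Poly_Mapping.lookup (Poly_Mapping.map ((*) c) p) m = c * Poly_Mapping.lookup p m"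
    by (simp add: Poly_Mapping.map.rep_eq when_def)
  then show ?thesis
    by (simp add: Const_def mult_map_scale_conv_mult)
qed

lemma poly_at_add: "poly_at (p + q) x = poly_at p x + poly_at q x"
  unfolding poly_at_def by (rule sum_keys_add) auto

lemma poly_at_mult: "poly_at (p * q) x = poly_at p x * poly_at q x"
  unfolding poly_at_def
  by (rule sum_keys_mult) (auto simp: lookup_add power_add prod.distrib)

lemma poly_at_Const [simp]: "poly_at (Const c) x = c"
  by (simp add: poly_at_def Const_def)

lemma poly_at_0 [simp]: "poly_at 0 x = 0"
  by (simp add: poly_at_def)

lemma poly_at_1 [simp]: "poly_at 1 x = 1"
  using poly_at_Const[of 1] by simp

lemma poly_at_Var [simp]: "poly_at (Var i) x = x $ i"
proof -
  have "(\<Prod>j\<in>UNIV. (x $ j) ^ Poly_Mapping.lookup (Poly_Mapping.single i 1) j)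
      = (\<Prod>j\<in>UNIV. if j = i then x $ i else 1)"
    by (intro prod.cong) (auto simp: lookup_single when_def)
  then show ?thesis
    by (simp add: poly_at_def Var_def)
qed

lemma poly_at_sum: "poly_at (sum f A) x = (\<Sum>a\<in>A. poly_at (f a) x)"
  by (induction A rule: infinite_finite_induct) (simp_all add: poly_at_add)

lemma poly_subst_add: "poly_subst l (p + q) = poly_subst l p + poly_subst l q"
  unfolding poly_subst_def by (rule sum_keys_add) (auto simp: Const_add)

lemma poly_subst_mult: "poly_subst l (p * q) = poly_subst l p * poly_subst l q"
  unfolding poly_subst_def
  by (rule sum_keys_mult) (auto simp: Const_add Const_mult lookup_add power_add prod.distrib)

lemma poly_subst_Const [simp]: "poly_subst l (Const c) = Const c"
  by (simp add: poly_subst_def Const_def)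

lemma poly_subst_0 [simp]: "poly_subst l 0 = 0"
  by (simp add: poly_subst_def)

lemma poly_subst_1 [simp]: "poly_subst l 1 = 1"
  using poly_subst_Const[of l 1] by simp

lemma poly_subst_Var [simp]: "poly_subst l (Var i) = l i"
proof -
  have "(\<Prod>j\<in>UNIV. l j ^ Poly_Mapping.lookup (Poly_Mapping.single i 1) j)
      = (\<Prod>j\<in>UNIV. if j = i then l i else 1)"
    by (intro prod.cong) (auto simp: lookup_single when_def)
  then show ?thesis
    by (simp add: poly_subst_def Var_def)
qed

lemma poly_subst_sum: "poly_subst l (sum f A) = (\<Sum>a\<in>A. poly_subst l (f a))"
  by (induction A rule: infinite_finite_induct) (simp_all add: poly_subst_add)

subsection \<open>Degree\<close>

lemma mon_degree_add: "mon_degree (a + b) = mon_degree a + mon_degree b"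
  by (simp add: mon_degree_def lookup_add sum.distrib)

lemma mon_degree_0 [simp]: "mon_degree 0 = 0"
  by (simp add: mon_degree_def)

lemma mon_degree_single [simp]: "mon_degree (Poly_Mapping.single i k) = k"
  by (simp add: mon_degree_def lookup_single when_def)

lemma mon_degree_eq_0_iff: "mon_degree m = 0 \<longleftrightarrow> m = 0"
  by (auto simp: mon_degree_def poly_mapping_eq_iff fun_eq_iff)

lemma mon_degree_Suc:
  assumes "mon_degree m = Suc d"
  obtains i m' where "m = Poly_Mapping.single i 1 + m'" "mon_degree m' = d"
proof -
  obtain i where i: "Poly_Mapping.lookup m i \<noteq> 0"
    using assms by (metis lookup_zero mon_degree_0 nat.distinct(1) poly_mapping_eqI)
  \<comment> \<open>Subtraction of exponents is truncated; it is exact here because the exponent of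
    \<open>i\<close> in \<open>m\<close> is nonzero.\<close>
  define m' where "m' = m - Poly_Mapping.single i 1"
  have m: "m = Poly_Mapping.single i 1 + m'"
  proof (rule poly_mapping_eqI)
    fix k
    show "Poly_Mapping.lookup m k = Poly_Mapping.lookup (Poly_Mapping.single i 1 + m') k"
      using i by (auto simp: m'_def lookup_add lookup_minus lookup_single when_def)
  qed
  moreover have "mon_degree m' = d"
    using assms mon_degree_add[of "Poly_Mapping.single i 1" m'] m by simp
  ultimately show thesis
    using that by blast
qed

lemma total_degree_le_iff:
  "total_degree p \<le> d \<longleftrightarrow> (\<forall>m\<in>Poly_Mapping.keys p. mon_degree m \<le> d)"
  by (simp add: total_degree_def)

lemma total_degree_add_le:
  assumes "total_degree p \<le> d" "total_degree q \<le> d"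
  shows "total_degree (p + q) \<le> d"
  using assms keys_add[of p q] unfolding total_degree_le_iff by blast

lemma total_degree_mult_le:
  assumes "total_degree p \<le> c" "total_degree q \<le> d"
  shows "total_degree (p * q) \<le> c + d"
proof -
  have "mon_degree m \<le> c + d" if m: "m \<in> Poly_Mapping.keys (p * q)" for m
  proof -
    obtain a b where "m = a + b" "a \<in> Poly_Mapping.keys p" "b \<in> Poly_Mapping.keys q"
      using keys_mult[of p q] m by blast
    then show ?thesis
      using assms by (simp add: total_degree_le_iff mon_degree_add add_mono)
  qed
  then show ?thesis
    by (simp add: total_degree_le_iff)
qed

lemma total_degree_Const [simp]: "total_degree (Const c) = 0"
  by (simp add: total_degree_def Const_def)

lemma total_degree_1 [simp]: "total_degree 1 = 0"
  by (simp add: total_degree_def)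

lemma total_degree_Var [simp]: "total_degree (Var i) = 1"
  by (simp add: total_degree_def Var_def)

lemma total_degree_sum_le:
  assumes "\<And>a. a \<in> A \<Longrightarrow> total_degree (f a) \<le> d"
  shows "total_degree (sum f A) \<le> d"
  using assms
proof (induction A rule: infinite_finite_induct)
  case (insert a A)
  then show ?case
    by (simp add: total_degree_add_le)
qed (simp_all add: total_degree_def)

lemma degree_bound_induct [consumes 1, case_names Const add Var]:
  assumes "total_degree p \<le> d"
    and Const: "\<And>d c. P d (Const c)"
    and add: "\<And>d p q. P d p \<Longrightarrow> P d q \<Longrightarrow> P d (p + q)"
    and Var: "\<And>d i p. P d p \<Longrightarrow> P (Suc d) (Var i * p)"
  shows "P d p"
proof -
  have single: "P d (Poly_Mapping.single m c)" if "mon_degree m \<le> d" for d m c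
    using that
  proof (induction d arbitrary: m)
    case 0
    then show ?case
      using Const[of 0 c] by (simp add: mon_degree_eq_0_iff Const_def)
  next
    case (Suc d)
    show ?case
    proof (cases "mon_degree m")
      case 0
      then show ?thesis
        using Const[of "Suc d" c] by (simp add: mon_degree_eq_0_iff Const_def)
    next
      case (Suc k)
      then obtain i m' where m: "m = Poly_Mapping.single i 1 + m'" and "mon_degree m' = k"
        by (rule mon_degree_Suc)
      then have "P (Suc d) (Var i * Poly_Mapping.single m' c)"
        using Suc Suc.IH Suc.prems Var by simp
      then show ?thesis
        by (simp add: m Var_def mult_single)
    qed
  qed
  have sum: "P d (sum f A)" if "\<And>a. a \<in> A \<Longrightarrow> P d (f a)"
    for f :: "('a \<Rightarrow>\<^sub>0 nat) \<Rightarrow> _" and A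
    using that
  proof (induction A rule: infinite_finite_induct)
    case (insert a A)
    then show ?case
      using add by simp
  \<comment> \<open>Empty and infinite sums are \<open>0\<close>, which is the constant polynomial
    \<open>Const 0\<close>.\<close>
  qed (use Const[of d 0] in simp_all)
  show ?thesis
    using assms(1)
    by (subst poly_mapping_sum_single) (auto intro!: sum single simp: total_degree_le_iff)
qed

lemma poly_at_poly_subst: "poly_at (poly_subst l g) x = poly_at g (affine_map l x)"
proof -
  \<comment> \<open>A trivial bound starts the induction; both sides are ring homomorphisms in
    \<open>g\<close> that agree on constants and variables.\<close>
  have "total_degree g \<le> total_degree g"
    by simp
  then show ?thesis
    by (induction rule: degree_bound_induct)
      (simp_all add: poly_subst_add poly_subst_mult poly_at_add poly_at_mult affine_map_def)
qed

text \<open>This reduces the cubature formula to monomials, written as lists of variables. With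
  \<open>F\<close> arbitrary in the induction, a leading variable is absorbed into the functional,
  since \<open>F (Var i * q)\<close> is again linear in \<open>q\<close>.\<close>

lemma linear_functional_eq_0:
  fixes p :: "'n::finite rpoly"
  assumes "total_degree p \<le> d" "linear_functional F"
    and "\<And>is. length is \<le> d \<Longrightarrow> F (prod_list (map Var is)) = 0"
  shows "F p = 0"
  using assms
proof (induction arbitrary: F rule: degree_bound_induct)
  case (Const d c)
  have "F (Const c * 1) = c * F 1"
    using Const(1) unfolding linear_functional_def by blast
  then show ?case
    using Const(2)[of "[]"] by simp
next
  case (add d p q)
  then have "F p = 0" "F q = 0"
    by blast+
  then show ?case
    using add.prems(1) by (simp add: linear_functional_def)
next
  case (Var d i p)
  have lin: "linear_functional (\<lambda>q. F (Var i * q))"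
    using Var.prems(1) unfolding linear_functional_def
    by (metis distrib_left mult.left_commute)
  show ?case
  proof (rule Var.IH[OF lin])
    fix "is" :: "'n list"
    assume "length is \<le> d"
    then show "F (Var i * prod_list (map Var is)) = 0"
      using Var.prems(2)[of "i # is"] by simp
  qed
qed

lemma degree_one_decomp:
  fixes p :: "'n::finite rpoly"
  assumes "total_degree p \<le> 1"
  shows "p = Const (Poly_Mapping.lookup p 0) + linear_part p"
proof -
  have nz: "Poly_Mapping.single i (1::nat) \<noteq> 0" for i :: 'n
    by (metis mon_degree_0 mon_degree_single zero_neq_one)
  have eq: "Poly_Mapping.single i (1::nat) = Poly_Mapping.single j 1 \<longleftrightarrow> i = j" for i j :: 'n
    by (metis lookup_single_eq lookup_single_not_eq zero_neq_one)
  \<comment> \<open>With the coefficient read at \<open>k\<close>, the sum has exactly one possibly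
    nonzero summand if \<open>k\<close> is a unit exponent, by \<open>eq\<close>, and none
    otherwise.\<close>
  have look: "Poly_Mapping.lookup (linear_part p) k = (\<Sum>i\<in>UNIV.
      if Poly_Mapping.single i 1 = k then Poly_Mapping.lookup p k else 0)" for k
    unfolding linear_part_def lookup_sum
    by (intro sum.cong) (auto simp: lookup_Const_mult Var_def lookup_single when_def)
  show ?thesis
  proof (rule poly_mapping_eqI)
    fix k :: "'n \<Rightarrow>\<^sub>0 nat"
    consider "mon_degree k = 0" | "mon_degree k = Suc 0" | "mon_degree k > 1"
      by linarith
    then show "Poly_Mapping.lookup p k =
        Poly_Mapping.lookup (Const (Poly_Mapping.lookup p 0) + linear_part p) k"
    proof cases
      case 1
      then show ?thesis
        using nz by (simp add: mon_degree_eq_0_iff lookup_add look Const_def)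
    next
      case 2
      then obtain j where k: "k = Poly_Mapping.single j 1"
        by (metis mon_degree_Suc mon_degree_eq_0_iff add_0_right)
      show ?thesis
        unfolding k lookup_add look eq using nz[of j]
        by (simp add: Const_def lookup_single when_def)
    next
      case 3
      then have "Poly_Mapping.lookup p k = 0"
        using assms by (force simp: total_degree_le_iff in_keys_iff)
      moreover have "k \<noteq> 0"
        using 3 by auto
      ultimately show ?thesis
        by (auto simp: lookup_add look Const_def lookup_single when_def intro!: sum.neutral)
    qed
  qed
qed

subsection \<open>Inverting the affine map\<close>

text \<open>Writing \<open>affine_map l\<close> as \<open>b + A *v x\<close>, independence of the
  linear parts says that the rows of \<open>A\<close> are independent, so \<open>A\<close> has an
  inverse \<open>C\<close>. Then \<open>C *v (y - b)\<close> gives both a preimage of each point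
  and, read as polynomials, a preimage of each variable.\<close>

lemma affine_inverse:
  fixes l :: "'n::finite \<Rightarrow> 'n rpoly"
  assumes deg: "\<And>i. total_degree (l i) \<le> 1"
    and indep: "\<And>c. (\<Sum>i\<in>UNIV. Const (c i) * linear_part (l i)) = 0 \<Longrightarrow> \<forall>i. c i = 0"
  shows "surj (affine_map l)"
    and "\<exists>r. total_degree r \<le> 1 \<and> poly_subst l r = Var i"
proof -
  define A :: "real^'n^'n" where
    "A = (\<chi> i j. Poly_Mapping.lookup (l i) (Poly_Mapping.single j 1))"
  define b :: "real^'n" where "b = (\<chi> i. Poly_Mapping.lookup (l i) 0)"
  have lin: "linear_part (l i) = (\<Sum>j\<in>UNIV. Const (A $ i $ j) * Var j)" for i
    by (simp add: linear_part_def A_def)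
  have l: "l i = Const (b $ i) + (\<Sum>j\<in>UNIV. Const (A $ i $ j) * Var j)" for i
    using degree_one_decomp[OF deg[of i]] by (simp add: lin b_def)
  \<comment> \<open>A kernel vector of the transpose is exactly the coefficient family of a
    vanishing combination of the linear parts.\<close>
  have "x = 0" if x: "transpose A *v x = 0" for x
  proof -
    have "(\<Sum>i\<in>UNIV. Const (x $ i) * linear_part (l i))
        = (\<Sum>j\<in>UNIV. Const ((transpose A *v x) $ j) * Var j)"
      unfolding lin sum_distrib_left
      by (subst sum.swap)
        (simp add: matrix_vector_mult_def transpose_def Const_sum Const_mult sum_distrib_left
          mult_ac)
    then have "\<forall>i. x $ i = 0"
      by (intro indep) (use x in simp)
    then show "x = 0"
      by (simp add: vec_eq_iff)
  qed
  then obtain B where "B ** transpose A = mat 1"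
    using matrix_left_invertible_ker[of "transpose A"] by blast
  define C where "C = transpose B"
  have AC: "A ** C = mat 1"
    using \<open>B ** transpose A = mat 1\<close> unfolding C_def
    by (metis matrix_transpose_mul transpose_mat transpose_transpose)
  then have CA: "C ** A = mat 1"
    by (simp add: matrix_left_right_inverse)
  have "affine_map l x = b + A *v x" for x
    unfolding affine_map_def vec_eq_iff
    by (subst l) (simp add: poly_at_add poly_at_sum poly_at_mult matrix_vector_mult_def)
  then have "affine_map l (C *v (y - b)) = y" for y
    by (simp add: matrix_vector_mul_assoc AC)
  then show "surj (affine_map l)"
    by (rule surjI)
  \<comment> \<open>Component \<open>i\<close> of the inverse affine map
    \<open>C *v (y - b)\<close>, as a polynomial in \<open>y\<close>.\<close>
  define r where "r = (\<Sum>j\<in>UNIV. Const (C $ i $ j) * (Var j + Const (- b $ j)))"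
  have "total_degree (Var j + Const (- b $ j)) \<le> 1" for j
    by (intro total_degree_add_le) simp_all
  then have "total_degree (Const (C $ i $ j) * (Var j + Const (- b $ j))) \<le> 0 + 1" for j
    by (intro total_degree_mult_le) simp_all
  then have "total_degree r \<le> 1"
    unfolding r_def by (intro total_degree_sum_le) simp
  moreover have "poly_subst l r = Var i"
  proof -
    have "poly_subst l r = (\<Sum>j\<in>UNIV. Const (C $ i $ j) * (l j + Const (- b $ j)))"
      by (simp add: r_def poly_subst_sum poly_subst_mult poly_subst_add)
    \<comment> \<open>The constant term \<open>b $ j\<close> of \<open>l j\<close> cancels against
      the shift.\<close>
    also have "\<dots> = (\<Sum>j\<in>UNIV. \<Sum>k\<in>UNIV. Const (C $ i $ j * A $ j $ k) * Var k)"
      by (subst l) (simp add: Const_uminus Const_mult sum_distrib_left mult_ac)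
    also have "\<dots> = (\<Sum>k\<in>UNIV. Const ((C ** A) $ i $ k) * Var k)"
      by (subst sum.swap) (simp add: matrix_matrix_mult_def Const_sum sum_distrib_right)
    also have "\<dots> = (\<Sum>k\<in>UNIV. if i = k then Var k else 0)"
      by (intro sum.cong) (simp_all add: CA mat_def)
    finally show ?thesis
      by simp
  qed
  ultimately show "\<exists>r. total_degree r \<le> 1 \<and> poly_subst l r = Var i"
    by blast
qed

text \<open>Substitution respects sums and products, so preimages of the variables, being of degree
  at most 1, yield a preimage of \<open>f\<close> without raising the degree bound.\<close>

lemma poly_subst_surj_degree:
  assumes "total_degree f \<le> d"
    and "\<And>i. \<exists>r. total_degree r \<le> 1 \<and> poly_subst l r = Var i"
  shows "\<exists>g. total_degree g \<le> d \<and> poly_subst l g = f"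
  using assms(1)
proof (induction rule: degree_bound_induct)
  case (Const d c)
  show ?case
    by (rule exI[of _ "Const c"]) simp
next
  case (add d p q)
  then show ?case
    by (metis poly_subst_add total_degree_add_le)
next
  case (Var d i p)
  then show ?case
    by (metis assms(2) poly_subst_mult total_degree_mult_le plus_1_eq_Suc)
qed

subsection \<open>The cubature formula\<close>

lemma linear_functional_transformed:
  assumes "linear_functional L"
  shows "linear_functional (transformed_functional L l)"
  using assms
  by (simp add: linear_functional_def transformed_functional_def poly_subst_add poly_subst_mult)

lemma linear_functional_cubature_error:
  assumes "linear_functional L"
  shows "linear_functional (\<lambda>g. L g - (\<Sum>m\<in>M. \<omega> m * poly_at g (x m)))"
  using assms
  by (simp add: linear_functional_def poly_at_add poly_at_mult sum.distrib sum_distrib_left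
      algebra_simps)

theorem mainTheorem4:
  fixes L :: "'n::finite rpoly \<Rightarrow> real"
    and e :: 'n
    and l :: "'n \<Rightarrow> 'n rpoly"
    and \<xi>1 \<xi>2 :: real
    and N :: nat
    and \<omega> :: "nat \<Rightarrow> real"
    and v :: "nat \<Rightarrow> 'n \<Rightarrow> real"
  assumes "CARD('n) \<ge> 2"
    and "linear_functional L"
    and "square_positive L"
    and "property_P_with L e l"
    and "\<xi>1 + \<xi>2 = transformed_functional L l 1"
    and "(\<Sum>m=1..N. \<omega> m) = \<xi>1"
    and "\<And>i. i \<noteq> e \<Longrightarrow>
           (\<Sum>m=1..N. \<omega> m * v m i) = transformed_functional L l (Var i)"
    and "\<And>i j. i \<noteq> e \<Longrightarrow> j \<noteq> e \<Longrightarrow>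
           (\<Sum>m=1..N. \<omega> m * v m i * v m j) = transformed_functional L l (Var i * Var j)"
    and "\<And>i j k. i \<noteq> e \<Longrightarrow> j \<noteq> e \<Longrightarrow> k \<noteq> e \<Longrightarrow>
           (\<Sum>m=1..N. \<omega> m * v m i * v m j * v m k)
             = transformed_functional L l (Var i * Var j * Var k)"
    and "\<omega> (N + 1) + \<omega> (N + 2) = \<xi>2"
    and "\<And>s. s \<in> {1, 2, 3} \<Longrightarrow>
           \<omega> (N + 1) * v (N + 1) e ^ s + \<omega> (N + 2) * v (N + 2) e ^ s
             = transformed_functional L l (Var e ^ s)"
  shows "(\<forall>g. total_degree g \<le> 3 \<longrightarrow>
            transformed_functional L l g
              = (\<Sum>m=1..N+2. \<omega> m * poly_at g (cubature_node e N v m))) \<and>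
         (\<forall>f. total_degree f \<le> 3 \<longrightarrow>
            L f = (\<Sum>m=1..N+2. \<omega> m * poly_at f (inv (affine_map l) (cubature_node e N v m))))"
proof -
  let ?L' = "transformed_functional L l"
  let ?x = "cubature_node e N v"
  let ?Q = "\<lambda>g. \<Sum>m=1..N+2. \<omega> m * poly_at g (?x m)"
  have deg: "total_degree (l i) \<le> 1" for i
    using assms(4) by (simp add: property_P_with_def)
  have indep: "\<forall>i. c i = 0" if "(\<Sum>i\<in>UNIV. Const (c i) * linear_part (l i)) = 0" for c
    using assms(4) that unfolding property_P_with_def by blast
  \<comment> \<open>The degree condition is on the substituted polynomial, because orthogonality is
    stated for \<open>L\<close> and not for the transformed functional.\<close>
  have orth: "?L' (Var i * Var e * p) = 0"
    if "i \<noteq> e" "total_degree (poly_subst l p) \<le> 1" for i p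
    using assms(4) that
    by (simp add: property_P_with_def orthogonal_polynomial_def transformed_functional_def
        poly_subst_mult)
  have orth1: "?L' (Var i * Var e) = 0" if "i \<noteq> e" for i
    using orth[OF that, of 1] by simp
  have orth2: "?L' (Var i * Var e * Var j) = 0" if "i \<noteq> e" for i j
    using orth[OF that, of "Var j"] deg by simp

  have Q: "?Q g = (\<Sum>m=1..N. \<omega> m * poly_at g (?x m))
      + \<omega> (N + 1) * poly_at g (?x (N + 1)) + \<omega> (N + 2) * poly_at g (?x (N + 2))" for g
    by (simp add: numeral_2_eq_2)
  have node_le: "?x m $ i = (if i = e then 0 else v m i)" if "m \<le> N" for m i
    using that by (simp add: cubature_node_def)
  have node_gt: "?x (Suc N) $ i = (if i = e then v (N + 1) e else 0)"
    "?x (Suc (Suc N)) $ i = (if i = e then v (N + 2) e else 0)" for i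
    by (simp_all add: cubature_node_def)
  note moments = assms(5-9) assms(10) assms(11)[of 1] assms(11)[of 2] assms(11)[of 3]
  have mono: "?L' (prod_list (map Var is)) = ?Q (prod_list (map Var is))"
    if len: "length is \<le> 3" for "is"
  proof -
    \<comment> \<open>The constant is the only monomial to which both families of nodes contribute
      in general; this is where \<open>\<xi>1 + \<xi>2\<close> enters.\<close>
    have F0: "?L' 1 = ?Q 1"
      unfolding Q using moments(1,2,6) by simp
    have F1: "?L' (Var i) = ?Q (Var i)" for i
      unfolding Q using moments(3)[of i] moments(7)
      by (cases "i = e") (simp_all add: poly_at_mult node_le node_gt)
    have F2: "?L' (Var i * Var j) = ?Q (Var i * Var j)" for i j
      unfolding Q using moments(4)[of i j] moments(8) orth1[of i] orth1[of j]
      by (cases "i = e"; cases "j = e")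
        (simp_all add: poly_at_mult node_le node_gt mult_ac power2_eq_square)
    \<comment> \<open>A mixed product contains one factor with index \<open>e\<close> and one with
      another index, in any positions; the six instances of \<open>orth2\<close> cover every choice
      of this pair.\<close>
    have F3: "?L' (Var i * Var j * Var k) = ?Q (Var i * Var j * Var k)" for i j k
      unfolding Q using moments(5)[of i j k] moments(9)
        orth2[of i k] orth2[of j k] orth2[of i j] orth2[of j i] orth2[of k i] orth2[of k j]
      by (cases "i = e"; cases "j = e"; cases "k = e")
        (simp_all add: poly_at_mult node_le node_gt mult_ac power3_eq_cube)
    consider "is = []" | i where "is = [i]" | i j where "is = [i, j]"
      | i j k where "is = [i, j, k]"
    proof -
      have "length is = 0 \<or> length is = 1 \<or> length is = 2 \<or> length is = 3"
        using len by linarith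
      then show thesis
        using that by (auto simp: length_Suc_conv numeral_2_eq_2 numeral_3_eq_3)
    qed
    then show ?thesis
      using F0 F1 F2 F3 by cases (simp_all add: mult.assoc)
  qed
  have lin: "linear_functional (\<lambda>g. ?L' g - ?Q g)"
    by (intro linear_functional_cubature_error linear_functional_transformed assms(2))
  have cubature: "?L' g = ?Q g" if "total_degree g \<le> 3" for g
    using linear_functional_eq_0[OF that lin] mono by simp

  have "L f = (\<Sum>m=1..N+2. \<omega> m * poly_at f (inv (affine_map l) (?x m)))"
    if f: "total_degree f \<le> 3" for f
  proof -
    \<comment> \<open>This \<open>g\<close> is \<open>f\<close> rewritten in the coordinates
      \<open>t\<close>, still of degree at most 3, so the formula for the transformed functional
      applies to it.\<close>
    obtain g where g: "total_degree g \<le> 3" "poly_subst l g = f"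
      using poly_subst_surj_degree[OF f affine_inverse(2)[where l = l, OF deg indep]] by blast
    \<comment> \<open>Surjectivity makes \<open>inv (affine_map l)\<close> a right inverse, so
      evaluating \<open>poly_subst l g\<close> at the pulled-back point returns the value of
      \<open>g\<close> at \<open>y\<close>.\<close>
    have "poly_at f (inv (affine_map l) y) = poly_at g y" for y
      using poly_at_poly_subst[of l g] g(2) surj_f_inv_f[OF affine_inverse(1)[where l = l, OF deg indep]]
      by simp
    then show ?thesis
      using cubature[OF g(1)] g(2) by (simp add: transformed_functional_def)
  qed
  with cubature show ?thesis
    by blast
qed

end
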